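(* Let $\Phi=\{(\alpha_1,w_1),\ldots,(\alpha_k,w_k)\}$ be a quantified Markov Logic Network (QMLN) and let $\Phi'=\{(\operatorname{neg}(\alpha_1),-w_1),(\alpha_2,w_2),\ldots,(\alpha_k,w_k)\}$, i.e. $\Phi'$ is $\Phi$ with the first weighted sentence $(\alpha_1,w_1)$ replaced by $(\operatorname{neg}(\alpha_1),-w_1)$. Then, for every domain $\Delta$ and every $\omega\in\Omega(\sigma,\Delta)$, $$p_{\Phi,\Delta}(\omega)=p_{\Phi',\Delta}(\omega).$$
   Context: First-order logic (FOL) is function-free with a finite set $\mathbf C$ of constants; $\sigma$ is a vocabulary, i.e. a finite set of predicate names with arities, assumed to be the predicate names used in the formulas. A domain $\Delta$ is a finite set with $\mathbf C\subseteq\Delta$. $\Omega(\sigma,\Delta)$ is the set of all $\sigma$-structures over $\Delta$ (sets of facts $R(a_1,\ldots,a_n)$ with $R\in\sigma$ of arity $n$ and $a_i\in\Delta$), called possible worlds. A quantified sentence is $\alpha=Q_1x_1\ldots Q_nx_n\colon\varphi(x_1,\ldots,x_n)$ with $Q_i\in\{\forall,\exists,\forall^*\}$ and $\varphi$ an FOL formula with free variables precisely $x_1,\ldots,x_n$. Its negation is $\operatorname{neg}(\alpha)=\overline{Q_1}x_1\ldots\overline{Q_n}x_n\colon\neg\varphi(x_1,\ldots,x_n)$, where $\overline\exists=\forall$, $\overline\forall=\exists$, $\overline{\forall^*}=\forall^*$. The statistic $Q_\omega(\alpha)$ in a world $\omega$ is defined recursively: if $\alpha$ is an FOL sentence (contains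 no $\forall^*$), $Q_\omega(\alpha)=1$ if $\omega\models\alpha$ and $0$ otherwise; otherwise $Q_\omega(\forall x\colon\alpha')=\min_{a\in\Delta}Q_\omega(\alpha'[x/a])$, $Q_\omega(\exists x\colon\alpha')=\max_{a\in\Delta}Q_\omega(\alpha'[x/a])$, $Q_\omega(\forall^* x\colon\alpha')=\frac1{|\Delta|}\sum_{a\in\Delta}Q_\omega(\alpha'[x/a])$. A QMLN is a finite set $\Phi$ of pairs $(\alpha,w)$, with $\alpha$ a quantified sentence and $w\in\mathbb R\cup\{+\infty,-\infty\}$. $\Phi_S$ is the set of pairs in $\Phi$ with finite weight. $\Phi_H$ consists of: for each $(\alpha,+\infty)\in\Phi$, the FOL sentence obtained from $\alpha$ by replacing each $\forall^*$ by $\forall$; and for each $(\alpha,-\infty)\in\Phi$ with $\alpha=Q_1x_1\ldots Q_nx_n\colon\varphi$, the sentence $\widetilde{Q_1}x_1\ldots\widetilde{Q_n}x_n\colon\neg\varphi$ where $\widetilde{\forall^*}=\forall$, $\widetilde\forall=\exists$, $\widetilde\exists=\forall$. Then $p_{\Phi,\Delta}(\omega)=\frac1Z\exp\left(\sum_{(\alpha,w)\in\Phi_S}w\cdot Q_\omega(\alpha)\right)$ if $\omega\models\Phi_H$ and $0$ otherwise, with $Z$ a normalization constant.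
   Formalization: A QMLN is taken as a finite multiset of weighted sentences rather than a set, so the replacement is kept with multiplicity if (neg(α₁), −w₁) already occurs among the other pairs; with literal sets the claim fails in that case. *)

theory Defs
  imports "HOL-Library.Extended_Real" "HOL-Library.Multiset"
begin

text \<open>Constants and domain elements share the type \<open>'a\<close>: constants denote themselves, and
  every domain element may be substituted for a variable.\<close>

datatype ('v, 'a) trm = Var 'v | Cst 'a

datatype ('p, 'v, 'a) fm =
    Atom 'p "('v, 'a) trm list"
  | Eq "('v, 'a) trm" "('v, 'a) trm"
  | Neg "('p, 'v, 'a) fm"
  | Conj "('p, 'v, 'a) fm" "('p, 'v, 'a) fm"
  | Disj "('p, 'v, 'a) fm" "('p, 'v, 'a) fm"
  | Imp "('p, 'v, 'a) fm" "('p, 'v, 'a) fm"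
  | Iff "('p, 'v, 'a) fm" "('p, 'v, 'a) fm"
  | All 'v "('p, 'v, 'a) fm"
  | Ex 'v "('p, 'v, 'a) fm"

fun tvars :: "('v, 'a) trm \<Rightarrow> 'v set" where
  "tvars (Var x) = {x}"
| "tvars (Cst a) = {}"

fun tconsts :: "('v, 'a) trm \<Rightarrow> 'a set" where
  "tconsts (Var x) = {}"
| "tconsts (Cst a) = {a}"

fun fv :: "('p, 'v, 'a) fm \<Rightarrow> 'v set" where
  "fv (Atom R ts) = (\<Union>t\<in>set ts. tvars t)"
| "fv (Eq s t) = tvars s \<union> tvars t"
| "fv (Neg \<phi>) = fv \<phi>"
| "fv (Conj \<phi> \<psi>) = fv \<phi> \<union> fv \<psi>"
| "fv (Disj \<phi> \<psi>) = fv \<phi> \<union> fv \<psi>"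
| "fv (Imp \<phi> \<psi>) = fv \<phi> \<union> fv \<psi>"
| "fv (Iff \<phi> \<psi>) = fv \<phi> \<union> fv \<psi>"
| "fv (All x \<phi>) = fv \<phi> - {x}"
| "fv (Ex x \<phi>) = fv \<phi> - {x}"

text \<open>A vocabulary is a partial map of finite domain from predicate names to arities.\<close>

type_synonym 'p vocabulary = "'p \<rightharpoonup> nat"

fun wf_fm :: "'a set \<Rightarrow> 'p vocabulary \<Rightarrow> ('p, 'v, 'a) fm \<Rightarrow> bool" where
  "wf_fm C \<sigma> (Atom R ts) \<longleftrightarrow> \<sigma> R = Some (length ts) \<and> (\<forall>t\<in>set ts. tconsts t \<subseteq> C)"
| "wf_fm C \<sigma> (Eq s t) \<longleftrightarrow> tconsts s \<subseteq> C \<and> tconsts t \<subseteq> C"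
| "wf_fm C \<sigma> (Neg \<phi>) \<longleftrightarrow> wf_fm C \<sigma> \<phi>"
| "wf_fm C \<sigma> (Conj \<phi> \<psi>) \<longleftrightarrow> wf_fm C \<sigma> \<phi> \<and> wf_fm C \<sigma> \<psi>"
| "wf_fm C \<sigma> (Disj \<phi> \<psi>) \<longleftrightarrow> wf_fm C \<sigma> \<phi> \<and> wf_fm C \<sigma> \<psi>"
| "wf_fm C \<sigma> (Imp \<phi> \<psi>) \<longleftrightarrow> wf_fm C \<sigma> \<phi> \<and> wf_fm C \<sigma> \<psi>"
| "wf_fm C \<sigma> (Iff \<phi> \<psi>) \<longleftrightarrow> wf_fm C \<sigma> \<phi> \<and> wf_fm C \<sigma> \<psi>"
| "wf_fm C \<sigma> (All x \<phi>) \<longleftrightarrow> wf_fm C \<sigma> \<phi>"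
| "wf_fm C \<sigma> (Ex x \<phi>) \<longleftrightarrow> wf_fm C \<sigma> \<phi>"

fun tsubst :: "'v \<Rightarrow> 'a \<Rightarrow> ('v, 'a) trm \<Rightarrow> ('v, 'a) trm" where
  "tsubst x a (Var y) = (if y = x then Cst a else Var y)"
| "tsubst x a (Cst b) = Cst b"

fun subst :: "'v \<Rightarrow> 'a \<Rightarrow> ('p, 'v, 'a) fm \<Rightarrow> ('p, 'v, 'a) fm" where
  "subst x a (Atom R ts) = Atom R (map (tsubst x a) ts)"
| "subst x a (Eq s t) = Eq (tsubst x a s) (tsubst x a t)"
| "subst x a (Neg \<phi>) = Neg (subst x a \<phi>)"
| "subst x a (Conj \<phi> \<psi>) = Conj (subst x a \<phi>) (subst x a \<psi>)"
| "subst x a (Disj \<phi> \<psi>) = Disj (subst x a \<phi>) (subst x a \<psi>)"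
| "subst x a (Imp \<phi> \<psi>) = Imp (subst x a \<phi>) (subst x a \<psi>)"
| "subst x a (Iff \<phi> \<psi>) = Iff (subst x a \<phi>) (subst x a \<psi>)"
| "subst x a (All y \<phi>) = All y (if y = x then \<phi> else subst x a \<phi>)"
| "subst x a (Ex y \<phi>) = Ex y (if y = x then \<phi> else subst x a \<phi>)"

lemma size_tsubst [simp]: "size (tsubst x a t) = size t"
  by (cases t) auto

lemma size_subst [simp]: "size (subst x a \<phi>) = size \<phi>"
  by (induction \<phi>) (auto simp: comp_def)

type_synonym ('p, 'a) world = "('p \<times> 'a list) set"

definition worlds :: "'p vocabulary \<Rightarrow> 'a set \<Rightarrow> ('p, 'a) world set" where
  "worlds \<sigma> \<Delta> = Pow {(R, as). \<sigma> R = Some (length as) \<and> set as \<subseteq> \<Delta>}"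

text \<open>Satisfaction is meant for sentences; an atom that still contains a variable counts as
  false.\<close>

fun holds :: "'a set \<Rightarrow> ('p, 'a) world \<Rightarrow> ('p, 'v, 'a) fm \<Rightarrow> bool" where
  "holds \<Delta> \<omega> (Atom R ts) \<longleftrightarrow> (\<exists>as. ts = map Cst as \<and> (R, as) \<in> \<omega>)"
| "holds \<Delta> \<omega> (Eq s t) \<longleftrightarrow> (\<exists>a. s = Cst a \<and> t = Cst a)"
| "holds \<Delta> \<omega> (Neg \<phi>) \<longleftrightarrow> \<not> holds \<Delta> \<omega> \<phi>"
| "holds \<Delta> \<omega> (Conj \<phi> \<psi>) \<longleftrightarrow> holds \<Delta> \<omega> \<phi> \<and> holds \<Delta> \<omega> \<psi>"
| "holds \<Delta> \<omega> (Disj \<phi> \<psi>) \<longleftrightarrow> holds \<Delta> \<omega> \<phi> \<or> holds \<Delta> \<omega> \<psi>"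
| "holds \<Delta> \<omega> (Imp \<phi> \<psi>) \<longleftrightarrow> (holds \<Delta> \<omega> \<phi> \<longrightarrow> holds \<Delta> \<omega> \<psi>)"
| "holds \<Delta> \<omega> (Iff \<phi> \<psi>) \<longleftrightarrow> (holds \<Delta> \<omega> \<phi> \<longleftrightarrow> holds \<Delta> \<omega> \<psi>)"
| "holds \<Delta> \<omega> (All x \<phi>) \<longleftrightarrow> (\<forall>a\<in>\<Delta>. holds \<Delta> \<omega> (subst x a \<phi>))"
| "holds \<Delta> \<omega> (Ex x \<phi>) \<longleftrightarrow> (\<exists>a\<in>\<Delta>. holds \<Delta> \<omega> (subst x a \<phi>))"

datatype quant = Forall | Exists | ForallStar

datatype ('p, 'v, 'a) qsent =
    Matrix "('p, 'v, 'a) fm"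
  | Quant quant 'v "('p, 'v, 'a) qsent"

fun matrix :: "('p, 'v, 'a) qsent \<Rightarrow> ('p, 'v, 'a) fm" where
  "matrix (Matrix \<phi>) = \<phi>"
| "matrix (Quant q x \<alpha>) = matrix \<alpha>"

fun prefix_vars :: "('p, 'v, 'a) qsent \<Rightarrow> 'v list" where
  "prefix_vars (Matrix \<phi>) = []"
| "prefix_vars (Quant q x \<alpha>) = x # prefix_vars \<alpha>"

definition quantified_sentence :: "'a set \<Rightarrow> 'p vocabulary \<Rightarrow> ('p, 'v, 'a) qsent \<Rightarrow> bool" where
  "quantified_sentence C \<sigma> \<alpha> \<longleftrightarrow>
     wf_fm C \<sigma> (matrix \<alpha>) \<and> distinct (prefix_vars \<alpha>) \<and> fv (matrix \<alpha>) = set (prefix_vars \<alpha>)"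

fun neg_quant :: "quant \<Rightarrow> quant" where
  "neg_quant Exists = Forall"
| "neg_quant Forall = Exists"
| "neg_quant ForallStar = ForallStar"

fun neg :: "('p, 'v, 'a) qsent \<Rightarrow> ('p, 'v, 'a) qsent" where
  "neg (Matrix \<phi>) = Matrix (Neg \<phi>)"
| "neg (Quant q x \<alpha>) = Quant (neg_quant q) x (neg \<alpha>)"

fun star_free :: "('p, 'v, 'a) qsent \<Rightarrow> bool" where
  "star_free (Matrix \<phi>) \<longleftrightarrow> True"
| "star_free (Quant q x \<alpha>) \<longleftrightarrow> q \<noteq> ForallStar \<and> star_free \<alpha>"

text \<open>\<open>fol \<alpha>\<close> is the first-order sentence obtained from \<open>\<alpha>\<close> by replacing each \<open>\<forall>\<^sup>*\<close> by \<open>\<forall>\<close>.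
  If \<open>\<alpha>\<close> contains no \<open>\<forall>\<^sup>*\<close>, it is \<open>\<alpha>\<close> itself, read as a first-order sentence.\<close>

fun fol :: "('p, 'v, 'a) qsent \<Rightarrow> ('p, 'v, 'a) fm" where
  "fol (Matrix \<phi>) = \<phi>"
| "fol (Quant Forall x \<alpha>) = All x (fol \<alpha>)"
| "fol (Quant Exists x \<alpha>) = Ex x (fol \<alpha>)"
| "fol (Quant ForallStar x \<alpha>) = All x (fol \<alpha>)"

fun tilde_quant :: "quant \<Rightarrow> quant" where
  "tilde_quant ForallStar = Forall"
| "tilde_quant Forall = Exists"
| "tilde_quant Exists = Forall"

fun tilde :: "('p, 'v, 'a) qsent \<Rightarrow> ('p, 'v, 'a) qsent" where
  "tilde (Matrix \<phi>) = Matrix (Neg \<phi>)"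
| "tilde (Quant q x \<alpha>) = Quant (tilde_quant q) x (tilde \<alpha>)"

fun qsubst :: "'v \<Rightarrow> 'a \<Rightarrow> ('p, 'v, 'a) qsent \<Rightarrow> ('p, 'v, 'a) qsent" where
  "qsubst x a (Matrix \<phi>) = Matrix (subst x a \<phi>)"
| "qsubst x a (Quant q y \<alpha>) = Quant q y (if y = x then \<alpha> else qsubst x a \<alpha>)"

lemma size_qsubst [simp]: "size (qsubst x a \<alpha>) = size \<alpha>"
  by (induction \<alpha>) auto

fun statistic :: "'a set \<Rightarrow> ('p, 'a) world \<Rightarrow> ('p, 'v, 'a) qsent \<Rightarrow> real" where
  "statistic \<Delta> \<omega> (Matrix \<phi>) = (if holds \<Delta> \<omega> \<phi> then 1 else 0)"
| "statistic \<Delta> \<omega> (Quant q x \<alpha>) =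
    (if star_free (Quant q x \<alpha>) then (if holds \<Delta> \<omega> (fol (Quant q x \<alpha>)) then 1 else 0)
     else case q of
       Forall \<Rightarrow> Min ((\<lambda>a. statistic \<Delta> \<omega> (qsubst x a \<alpha>)) ` \<Delta>)
     | Exists \<Rightarrow> Max ((\<lambda>a. statistic \<Delta> \<omega> (qsubst x a \<alpha>)) ` \<Delta>)
     | ForallStar \<Rightarrow> 1 / real (card \<Delta>) * (\<Sum>a\<in>\<Delta>. statistic \<Delta> \<omega> (qsubst x a \<alpha>)))"

text \<open>Networks are multisets of weighted sentences, so that replacing one of the \<open>k\<close> weighted
  sentences always yields \<open>k\<close> weighted sentences again. With sets, the replacement could coincide
  with a pair already present and be lost from the sum: \<open>{(\<alpha>, w), (neg \<alpha>, -w)}\<close> would become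
  \<open>{(neg \<alpha>, -w)}\<close>, which in general has a different distribution. A finite set is the special
  case without repetitions.\<close>

type_synonym ('p, 'v, 'a) network = "(('p, 'v, 'a) qsent \<times> ereal) multiset"

definition qmln :: "'a set \<Rightarrow> 'p vocabulary \<Rightarrow> ('p, 'v, 'a) network \<Rightarrow> bool" where
  "qmln C \<sigma> \<Phi> \<longleftrightarrow> (\<forall>(\<alpha>, w)\<in>#\<Phi>. quantified_sentence C \<sigma> \<alpha>)"

definition soft :: "('p, 'v, 'a) network \<Rightarrow> ('p, 'v, 'a) network" where
  "soft \<Phi> = {#(\<alpha>, w) \<in># \<Phi>. \<bar>w\<bar> \<noteq> \<infinity>#}"

definition hard :: "('p, 'v, 'a) network \<Rightarrow> ('p, 'v, 'a) fm set" where
  "hard \<Phi> = {fol \<alpha> | \<alpha>. (\<alpha>, \<infinity>) \<in># \<Phi>} \<union> {fol (tilde \<alpha>) | \<alpha>. (\<alpha>, -\<infinity>) \<in># \<Phi>}"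

definition unnormalized ::
  "'a set \<Rightarrow> ('p, 'v, 'a) network \<Rightarrow> ('p, 'a) world \<Rightarrow> real" where
  "unnormalized \<Delta> \<Phi> \<omega> =
     (if \<forall>\<psi>\<in>hard \<Phi>. holds \<Delta> \<omega> \<psi>
      then exp (\<Sum>(\<alpha>, w)\<in>#soft \<Phi>. real_of_ereal w * statistic \<Delta> \<omega> \<alpha>)
      else 0)"

text \<open>If no world satisfies the hard constraints, the normalization constant is 0 and every
  world gets probability \<open>0 / 0 = 0\<close>.\<close>

definition qmln_prob ::
  "'p vocabulary \<Rightarrow> 'a set \<Rightarrow> ('p, 'v, 'a) network \<Rightarrow> ('p, 'a) world \<Rightarrow> real" where
  "qmln_prob \<sigma> \<Delta> \<Phi> \<omega> =
     unnormalized \<Delta> \<Phi> \<omega> / (\<Sum>\<omega>'\<in>worlds \<sigma> \<Delta>. unnormalized \<Delta> \<Phi> \<omega>')"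

text \<open>As usual in first-order logic, domains are nonempty (which matters only if there are no
  constants).\<close>

definition is_domain :: "'a set \<Rightarrow> 'a set \<Rightarrow> bool" where
  "is_domain C \<Delta> \<longleftrightarrow> finite \<Delta> \<and> \<Delta> \<noteq> {} \<and> C \<subseteq> \<Delta>"

end

theory Submission
  imports Defs
begin

text \<open>Negating a quantified sentence turns its statistic \<open>q\<close> into \<open>1 - q\<close>, so a finite weight \<open>w\<close>
  contributes \<open>- w * (1 - q) = w * q - w\<close> after the replacement: every unnormalized weight is
  multiplied by the same constant \<open>exp (- w)\<close>, which cancels in the normalization. For an infinite
  weight the hard constraints before and after the replacement are logically equivalent.\<close>

lemma fol_qsubst: "fol (qsubst x a \<alpha>) = subst x a (fol \<alpha>)"
proof (induction \<alpha>)
  case (Quant q y \<alpha>)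
  then show ?case by (cases q) auto
qed simp

lemma neg_qsubst: "neg (qsubst x a \<alpha>) = qsubst x a (neg \<alpha>)"
  by (induction \<alpha>) auto

lemma tilde_qsubst: "tilde (qsubst x a \<alpha>) = qsubst x a (tilde \<alpha>)"
  by (induction \<alpha>) auto

lemma star_free_qsubst [simp]: "star_free (qsubst x a \<alpha>) \<longleftrightarrow> star_free \<alpha>"
  by (induction \<alpha>) auto

lemma star_free_neg [simp]: "star_free (neg \<alpha>) \<longleftrightarrow> star_free \<alpha>"
proof (induction \<alpha>)
  case (Quant q y \<alpha>)
  then show ?case by (cases q) auto
qed simp

text \<open>\<open>neg\<close> and \<open>tilde\<close> differ only on \<open>ForallStar\<close>,
  where \<open>neg\<close> keeps it and \<open>tilde\<close> gives \<open>Forall\<close>;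
  \<open>fol\<close> reads both as \<open>All\<close>. Hence weight -\<infinity> on \<alpha> and
  \<infinity> on \<open>neg \<alpha>\<close> impose the same hard constraint.\<close>

lemma fol_neg: "fol (neg \<alpha>) = fol (tilde \<alpha>)"
proof (induction \<alpha>)
  case (Quant q y \<alpha>)
  then show ?case by (cases q) auto
qed simp

text \<open>Quantifier duality. It breaks at \<open>ForallStar\<close>, which \<open>neg\<close>
  leaves in place, so that \<open>fol\<close> yields \<open>All\<close> on both sides.\<close>

lemma holds_fol_neg:
  "star_free \<alpha> \<Longrightarrow> holds \<Delta> \<omega> (fol (neg \<alpha>)) \<longleftrightarrow> \<not> holds \<Delta> \<omega> (fol \<alpha>)"
\<comment> \<open>\<open>holds\<close> descends to substitution instances of \<beta>, which are not
  subterms of \<alpha> but have the size of \<beta>.\<close>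
proof (induction "size \<alpha>" arbitrary: \<alpha> rule: less_induct)
  case less
  show ?case
  proof (cases \<alpha>)
    case (Quant q x \<beta>)
    have "holds \<Delta> \<omega> (subst x a (fol (neg \<beta>))) \<longleftrightarrow> \<not> holds \<Delta> \<omega> (subst x a (fol \<beta>))" for a
      using less.hyps[of "qsubst x a \<beta>"] less.prems Quant by (simp add: fol_qsubst neg_qsubst)
    then show ?thesis
      using less.prems Quant by (cases q) auto
  qed simp
qed

text \<open>The two flips cancel on \<open>Forall\<close> and \<open>Exists\<close>, and
  \<open>ForallStar\<close> ends as \<open>Forall\<close>, just as \<open>fol\<close> reads it. The
  matrix is doubly negated, hence an equivalence and not an equation.\<close>

lemma holds_fol_tilde_neg: "holds \<Delta> \<omega> (fol (tilde (neg \<alpha>))) \<longleftrightarrow> holds \<Delta> \<omega> (fol \<alpha>)"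
proof (induction "size \<alpha>" arbitrary: \<alpha> rule: less_induct)
  case less
  show ?case
  proof (cases \<alpha>)
    case (Quant q x \<beta>)
    have "holds \<Delta> \<omega> (subst x a (fol (tilde (neg \<beta>)))) \<longleftrightarrow> holds \<Delta> \<omega> (subst x a (fol \<beta>))" for a
      using less[of "qsubst x a \<beta>"] Quant by (simp add: fol_qsubst neg_qsubst tilde_qsubst)
    then show ?thesis
      using Quant by (cases q) auto
  qed simp
qed

text \<open>Subtraction from a constant reverses the order. With \<open>c = 1\<close>, this and its
  dual match the exchange of \<open>Forall\<close> and \<open>Exists\<close> under
  \<open>neg\<close>.\<close>

lemma Max_diff_const:
  fixes f :: "'b \<Rightarrow> 'c :: linordered_ab_group_add"
  assumes "finite A" "A \<noteq> {}"
  shows "Max ((\<lambda>a. c - f a) ` A) = c - Min (f ` A)"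
proof (rule Max_eqI)
  show "c - Min (f ` A) \<in> (\<lambda>a. c - f a) ` A"
  proof -
    obtain b where "b \<in> A" "f b = Min (f ` A)"
      using Min_in[of "f ` A"] assms by fastforce
    then show ?thesis
      by (metis (mono_tags) image_eqI)
  qed
qed (use assms in auto)

lemma Min_diff_const:
  fixes f :: "'b \<Rightarrow> 'c :: linordered_ab_group_add"
  assumes "finite A" "A \<noteq> {}"
  shows "Min ((\<lambda>a. c - f a) ` A) = c - Max (f ` A)"
proof (rule Min_eqI)
  show "c - Max (f ` A) \<in> (\<lambda>a. c - f a) ` A"
  proof -
    obtain b where "b \<in> A" "f b = Max (f ` A)"
      using Max_in[of "f ` A"] assms by fastforce
    then show ?thesis
      by (metis (mono_tags) image_eqI)
  qed
qed (use assms in auto)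

lemma statistic_neg:
  assumes "finite \<Delta>" "\<Delta> \<noteq> {}"
  shows "statistic \<Delta> \<omega> (neg \<alpha>) = 1 - statistic \<Delta> \<omega> \<alpha>"
proof (induction "size \<alpha>" arbitrary: \<alpha> rule: less_induct)
  case less
  show ?case
  proof (cases \<alpha>)
    case (Quant q x \<beta>)
    show ?thesis
    proof (cases "star_free \<alpha>")
      case True
      then show ?thesis
        using holds_fol_neg[OF True] star_free_neg[of \<alpha>] Quant by simp
    next
      case False
      have IH: "statistic \<Delta> \<omega> (qsubst x a (neg \<beta>)) = 1 - statistic \<Delta> \<omega> (qsubst x a \<beta>)" for a
        using less[of "qsubst x a \<beta>"] Quant by (simp add: neg_qsubst)
      \<comment> \<open>The constant 1 has average 1 only over a nonempty domain; division by zero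
        would give 0.\<close>
      have "card \<Delta> \<noteq> 0"
        using assms by simp
      with False show ?thesis
        using Quant assms
        by (cases q) (simp_all add: IH Max_diff_const Min_diff_const sum_subtractf diff_divide_distrib)
    qed
  qed simp
qed

text \<open>The contribution of a single pair as a factor: a hard constraint becomes a 0/1
  indicator, so that finite and infinite weights can be treated alike.\<close>

definition weight_factor ::
  "'a set \<Rightarrow> ('p, 'a) world \<Rightarrow> ('p, 'v, 'a) qsent \<Rightarrow> ereal \<Rightarrow> real" where
  "weight_factor \<Delta> \<omega> \<alpha> w =
     (if w = \<infinity> then of_bool (holds \<Delta> \<omega> (fol \<alpha>))
      else if w = - \<infinity> then of_bool (holds \<Delta> \<omega> (fol (tilde \<alpha>)))
      else exp (real_of_ereal w * statistic \<Delta> \<omega> \<alpha>))"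

lemma unnormalized_add_mset:
  "unnormalized \<Delta> (add_mset (\<alpha>, w) \<Psi>) \<omega> = weight_factor \<Delta> \<omega> \<alpha> w * unnormalized \<Delta> \<Psi> \<omega>"
proof -
  have "hard (add_mset (\<alpha>, w) \<Psi>) =
      (if w = \<infinity> then {fol \<alpha>} else if w = - \<infinity> then {fol (tilde \<alpha>)} else {}) \<union> hard \<Psi>"
    unfolding hard_def by auto
  moreover have "soft (add_mset (\<alpha>, w) \<Psi>) =
      (if \<bar>w\<bar> = \<infinity> then soft \<Psi> else add_mset (\<alpha>, w) (soft \<Psi>))"
    unfolding soft_def by simp
  ultimately show ?thesis
    by (cases w) (auto simp: unnormalized_def weight_factor_def exp_add)
qed

text \<open>What matters is that the extra factor does not depend on \<omega>.\<close>

lemma weight_factor_neg: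
  assumes "finite \<Delta>" "\<Delta> \<noteq> {}"
  shows "weight_factor \<Delta> \<omega> (neg \<alpha>) (- w) =
    (if \<bar>w\<bar> = \<infinity> then 1 else exp (- real_of_ereal w)) * weight_factor \<Delta> \<omega> \<alpha> w"
  by (cases w)
    (auto simp: weight_factor_def fol_neg holds_fol_tilde_neg statistic_neg[OF assms]
      algebra_simps simp flip: exp_add)

text \<open>The constant \<open>c\<close> comes out of the normalizing sum and cancels; if that sum
  is 0, both quotients are 0.\<close>

lemma qmln_prob_cong_scale:
  assumes "c \<noteq> 0" and "\<And>\<omega>. unnormalized \<Delta> \<Phi>' \<omega> = c * unnormalized \<Delta> \<Phi> \<omega>"
  shows "qmln_prob \<sigma> \<Delta> \<Phi>' \<omega> = qmln_prob \<sigma> \<Delta> \<Phi> \<omega>"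
  using assms by (simp add: qmln_prob_def flip: sum_distrib_left)

theorem proposition4:
  fixes C :: "'a set" and \<sigma> :: "'p vocabulary"
    and \<alpha>\<^sub>1 :: "('p, 'v, 'a) qsent" and w\<^sub>1 :: ereal
    and \<Psi> :: "('p, 'v, 'a) network"
    and \<Delta> :: "'a set" and \<omega> :: "('p, 'a) world"
  assumes "finite C" and "finite (dom \<sigma>)"
    and "qmln C \<sigma> (add_mset (\<alpha>\<^sub>1, w\<^sub>1) \<Psi>)"
    and "is_domain C \<Delta>"
    and "\<omega> \<in> worlds \<sigma> \<Delta>"
  shows "qmln_prob \<sigma> \<Delta> (add_mset (\<alpha>\<^sub>1, w\<^sub>1) \<Psi>) \<omega>
       = qmln_prob \<sigma> \<Delta> (add_mset (neg \<alpha>\<^sub>1, - w\<^sub>1) \<Psi>) \<omega>"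
proof (rule sym, rule qmln_prob_cong_scale)
  have "finite \<Delta>" "\<Delta> \<noteq> {}"
    using assms(4) by (auto simp: is_domain_def)
  \<comment> \<open>This fixes \<open>c\<close>, uniformly in \<open>\<omega>'\<close>. It is 1 or
    an exponential, so the remaining goal \<open>c \<noteq> 0\<close> holds.\<close>
  then show "unnormalized \<Delta> (add_mset (neg \<alpha>\<^sub>1, - w\<^sub>1) \<Psi>) \<omega>' =
      (if \<bar>w\<^sub>1\<bar> = \<infinity> then 1 else exp (- real_of_ereal w\<^sub>1)) *
        unnormalized \<Delta> (add_mset (\<alpha>\<^sub>1, w\<^sub>1) \<Psi>) \<omega>'" for \<omega>'
    by (simp add: unnormalized_add_mset weight_factor_neg)
qed simp

end
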